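(* Let $H$ be a finite set, and work in $\mathbb{Q}[\beta, h_b^{U}: b\in H]$ with $h_b^{L}:=h_b^U-\beta$. A Stanley diagram is a map $D:H\to\{U,L\}$, identified with the monomial $\prod_{b\in H}h_b^{D_b}$; for a diagram $B$ and $L\subseteq H$ let $B^L$ be the diagram agreeing with $B$ off $L$ and opposite to $B$ on $L$, and write $\bar B_b$ for the opposite of $B_b$. Fix a diagram $B$, a nonempty $Y\subseteq H$, rationals $a_b$ ($b\in Y$) and $d$, and set $$f:=\sum_{b\in Y}a_b\,h_b^{B_b}+d\,\beta .$$ Let $\sigma_b\in\{\pm1\}$ be defined by $h_b^{\bar B_b}=h_b^{B_b}+\sigma_b\beta$ (so $\sigma_b=-1$ if $B_b=U$ and $\sigma_b=+1$ if $B_b=L$), and define $$k:=\sum_{L\subseteq Y}c_L\,B^L,\qquad c_L:=(-1)^{|L|}\Bigl(d-\sum_{b\in Y\setminus L}\sigma_b a_b\Bigr).$$ Then, as polynomials, $$k=(-1)^{|Y|}\Bigl(\prod_{b\in Y}\sigma_b\Bigr)\Bigl(\prod_{b\in H\setminus Y}h_b^{B_b}\Bigr)\beta^{|Y|-1}\,f .$$ In particular, any ring homomorphism (evaluation) that sends $f$ to $0$ sends $k$ to $0$.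
   Context: Here $h_b^U,h_b^L$ are formal "upper/lower hook symbols" of a box $b$, satisfying $h_b^U-h_b^L=\beta$ (the $\alpha$-hook lengths differ by $\alpha-1$, and $\beta$ evaluates to $\alpha-1$). The sum $k$ is called the kernel function of $f$ relative to $B$. *)

theory Defs
  imports Complex_Main "HOL-Library.Poly_Mapping" "HOL-Algebra.Ring"
begin

datatype side = Upper | Lower

fun opp :: "side \<Rightarrow> side" where
  "opp Upper = Lower"
| "opp Lower = Upper"

datatype 'b hook_var = Beta | HookU 'b

text \<open>
  Multivariate polynomials over the rationals: finitely supported maps from monomials
  (finitely supported exponent maps) to coefficients, with the convolution product.
\<close>

type_synonym 'b hook_poly = "('b hook_var \<Rightarrow>\<^sub>0 nat) \<Rightarrow>\<^sub>0 rat"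

definition pconst :: "rat \<Rightarrow> 'b hook_poly" where
  "pconst c = Poly_Mapping.single 0 c"

definition pvar :: "'b hook_var \<Rightarrow> 'b hook_poly" where
  "pvar x = Poly_Mapping.single (Poly_Mapping.single x 1) 1"

definition beta :: "'b hook_poly" where
  "beta = pvar Beta"

fun hook :: "'b \<Rightarrow> side \<Rightarrow> 'b hook_poly" where
  "hook b Upper = pvar (HookU b)"
| "hook b Lower = pvar (HookU b) - beta"

text \<open>
  The ring \<open>\<rat>[\<beta>, h\<^sub>b\<^sup>U : b \<in> H]\<close>: those polynomials in which only \<open>\<beta>\<close> and the
  indeterminates indexed by \<open>H\<close> occur.
\<close>

definition hook_ring :: "'b set \<Rightarrow> 'b hook_poly ring" where
  "hook_ring H =
     \<lparr>carrier = {p. \<forall>m \<in> Poly_Mapping.keys p. Poly_Mapping.keys m \<subseteq> insert Beta (HookU ` H)},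
      mult = (*), one = 1, zero = 0, add = (+)\<rparr>"

text \<open>
  A Stanley diagram on \<open>H\<close> is a map \<open>D :: 'b \<Rightarrow> side\<close>; only its values on \<open>H\<close> are ever used.
\<close>

definition diagram :: "'b set \<Rightarrow> ('b \<Rightarrow> side) \<Rightarrow> 'b hook_poly" where
  "diagram H D = (\<Prod>b\<in>H. hook b (D b))"

definition flip_on :: "('b \<Rightarrow> side) \<Rightarrow> 'b set \<Rightarrow> 'b \<Rightarrow> side" where
  "flip_on B L = (\<lambda>b. if b \<in> L then opp (B b) else B b)"

text \<open>The lemma \<open>hook_opp_iff\<close> below is the property that characterises the sign.\<close>

fun sigma :: "side \<Rightarrow> rat" where
  "sigma Upper = -1"
| "sigma Lower = 1"

definition hook_form :: "('b \<Rightarrow> side) \<Rightarrow> 'b set \<Rightarrow> ('b \<Rightarrow> rat) \<Rightarrow> rat \<Rightarrow> 'b hook_poly" where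
  "hook_form B Y a d = (\<Sum>b\<in>Y. pconst (a b) * hook b (B b)) + pconst d * beta"

definition kernel_coeff ::
  "('b \<Rightarrow> side) \<Rightarrow> 'b set \<Rightarrow> ('b \<Rightarrow> rat) \<Rightarrow> rat \<Rightarrow> 'b set \<Rightarrow> rat" where
  "kernel_coeff B Y a d L = (-1) ^ card L * (d - (\<Sum>b\<in>Y - L. sigma (B b) * a b))"

definition kernel_function ::
  "'b set \<Rightarrow> ('b \<Rightarrow> side) \<Rightarrow> 'b set \<Rightarrow> ('b \<Rightarrow> rat) \<Rightarrow> rat \<Rightarrow> 'b hook_poly" where
  "kernel_function H B Y a d =
     (\<Sum>L\<in>Pow Y. pconst (kernel_coeff B Y a d L) * diagram H (flip_on B L))"

lemma pconst_times_beta: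
  "pconst c * beta = Poly_Mapping.single (Poly_Mapping.single Beta 1) c"
  by (simp add: pconst_def beta_def pvar_def mult_single)

lemma hook_opp_iff:
  "hook b (opp s) = hook b s + pconst c * beta \<longleftrightarrow> c = sigma s"
proof -
  define t :: "rat \<Rightarrow> 'a hook_poly" where "t = Poly_Mapping.single (Poly_Mapping.single Beta 1)"
  have inj: "t x = t y \<longleftrightarrow> x = y" for x y
    unfolding t_def by (metis lookup_single_eq)
  have b: "beta = t 1" by (simp add: beta_def pvar_def t_def)
  have mb: "- beta = t (-1)" unfolding b by (simp add: t_def single_uminus)
  have pb: "pconst c * beta = t c" by (simp add: pconst_times_beta t_def)
  have diff: "hook b (opp s) - hook b s = t (sigma s)"
    by (cases s) (simp_all add: mb[symmetric] b[symmetric])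
  have "hook b (opp s) = hook b s + pconst c * beta \<longleftrightarrow> hook b (opp s) - hook b s = t c"
    unfolding pb by (metis add_diff_cancel_left' add.commute diff_add_cancel)
  then show ?thesis unfolding diff inj by auto
qed

lemma hook_ring_add:
  assumes "p \<in> carrier (hook_ring H)" "q \<in> carrier (hook_ring H)"
  shows "p + q \<in> carrier (hook_ring H)"
  using assms Poly_Mapping.keys_add[of p q] unfolding hook_ring_def by (simp, blast)

lemma hook_ring_uminus:
  assumes "p \<in> carrier (hook_ring H)"
  shows "- p \<in> carrier (hook_ring H)"
  using assms unfolding hook_ring_def by simp

lemma hook_ring_mult:
  assumes p: "p \<in> carrier (hook_ring H)" and q: "q \<in> carrier (hook_ring H)"
  shows "p * q \<in> carrier (hook_ring H)"
proof -
  have "Poly_Mapping.keys m \<subseteq> insert Beta (HookU ` H)" if "m \<in> Poly_Mapping.keys (p * q)" for m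
  proof -
    obtain m1 m2 where m: "m = m1 + m2" "m1 \<in> Poly_Mapping.keys p" "m2 \<in> Poly_Mapping.keys q"
      using \<open>m \<in> Poly_Mapping.keys (p * q)\<close> keys_mult[of p q] by blast
    have "Poly_Mapping.keys m1 \<subseteq> insert Beta (HookU ` H)"
         "Poly_Mapping.keys m2 \<subseteq> insert Beta (HookU ` H)"
      using p q m by (auto simp: hook_ring_def)
    then show ?thesis using Poly_Mapping.keys_add[of m1 m2] m by blast
  qed
  then show ?thesis by (simp add: hook_ring_def)
qed

lemma pconst_in_hook_ring: "pconst c \<in> carrier (hook_ring H)"
  by (simp add: hook_ring_def pconst_def)

lemma beta_in_hook_ring: "beta \<in> carrier (hook_ring H)"
  by (simp add: hook_ring_def beta_def pvar_def)

lemma hook_in_hook_ring: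
  assumes "b \<in> H" shows "hook b s \<in> carrier (hook_ring H)"
proof -
  have "pvar (HookU b) \<in> carrier (hook_ring H)"
    using assms by (simp add: hook_ring_def pvar_def)
  then show ?thesis
    using hook_ring_add[OF _ hook_ring_uminus[OF beta_in_hook_ring], of "pvar (HookU b)" H]
    by (cases s) simp_all
qed

lemma hook_ring_sum:
  "(\<And>i. i \<in> I \<Longrightarrow> p i \<in> carrier (hook_ring H)) \<Longrightarrow> sum p I \<in> carrier (hook_ring H)"
proof (induction I rule: infinite_finite_induct)
  case (insert x F)
  then show ?case by (simp add: hook_ring_add)
qed (simp_all add: hook_ring_def)

lemma hook_ring_prod:
  "(\<And>i. i \<in> I \<Longrightarrow> p i \<in> carrier (hook_ring H)) \<Longrightarrow> prod p I \<in> carrier (hook_ring H)"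
proof (induction I rule: infinite_finite_induct)
  case (insert x F)
  then show ?case by (simp add: hook_ring_mult)
qed (simp_all add: hook_ring_def)

lemma hook_ring_cring: "cring (hook_ring H)"
proof (rule cringI)
  show "abelian_group (hook_ring H)"
  proof (rule abelian_groupI)
    fix x y assume "x \<in> carrier (hook_ring H)" "y \<in> carrier (hook_ring H)"
    then have "x + y \<in> carrier (hook_ring H)" by (rule hook_ring_add)
    then show "x \<oplus>\<^bsub>hook_ring H\<^esub> y \<in> carrier (hook_ring H)" by (simp add: hook_ring_def)
  next
    fix x assume x: "x \<in> carrier (hook_ring H)"
    show "\<exists>y\<in>carrier (hook_ring H). y \<oplus>\<^bsub>hook_ring H\<^esub> x = \<zero>\<^bsub>hook_ring H\<^esub>"
      using hook_ring_uminus[OF x] by (rule rev_bexI) (simp add: hook_ring_def)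
  qed (simp_all add: hook_ring_def ac_simps)
  show "comm_monoid (hook_ring H)"
  proof (rule comm_monoidI)
    fix x y assume "x \<in> carrier (hook_ring H)" "y \<in> carrier (hook_ring H)"
    then have "x * y \<in> carrier (hook_ring H)" by (rule hook_ring_mult)
    then show "x \<otimes>\<^bsub>hook_ring H\<^esub> y \<in> carrier (hook_ring H)" by (simp add: hook_ring_def)
  qed (simp_all add: hook_ring_def ac_simps)
qed (simp add: hook_ring_def algebra_simps)

lemma hook_form_in_hook_ring:
  "Y \<subseteq> H \<Longrightarrow> hook_form B Y a d \<in> carrier (hook_ring H)"
  unfolding hook_form_def
  by (intro hook_ring_add hook_ring_sum hook_ring_mult pconst_in_hook_ring
        beta_in_hook_ring hook_in_hook_ring) blast

lemma kernel_function_in_hook_ring: "kernel_function H B Y a d \<in> carrier (hook_ring H)"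
  unfolding kernel_function_def diagram_def
  by (intro hook_ring_sum hook_ring_mult pconst_in_hook_ring hook_ring_prod hook_in_hook_ring)

end

theory Submission
  imports Defs
begin

text \<open>
  Write \<open>x\<^sub>b\<close> and \<open>y\<^sub>b\<close> for the two hook symbols of \<open>b\<close>. Expanding over one box at a time shows that
  the alternating sum over \<open>L\<close> of \<open>(d - \<Sum>\<^bsub>b \<in> Y - L\<^esub> t\<^sub>b) \<Prod>\<^bsub>b \<in> L\<^esub> y\<^sub>b \<Prod>\<^bsub>b \<in> Y - L\<^esub> x\<^sub>b\<close> equals
  \<open>d \<Prod>\<^bsub>b \<in> Y\<^esub> (x\<^sub>b - y\<^sub>b) - \<Sum>\<^bsub>b \<in> Y\<^esub> t\<^sub>b x\<^sub>b \<Prod>\<^bsub>c \<in> Y - {b}\<^esub> (x\<^sub>c - y\<^sub>c)\<close> in any commutative ring. Since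
  \<open>x\<^sub>b - y\<^sub>b = - \<sigma>\<^sub>b \<beta>\<close> and \<open>t\<^sub>b = \<sigma>\<^sub>b a\<^sub>b\<close>, the sign product and \<open>\<beta>\<^bsup>|Y| - 1\<^esup>\<close> factor out, leaving \<open>f\<close>.
\<close>

lemma sum_Pow_insert:
  assumes "finite Y" "c \<notin> Y"
  shows "sum g (Pow (insert c Y)) = (\<Sum>L\<in>Pow Y. g L + g (insert c L))"
proof -
  have "inj_on (insert c) (Pow Y)"
    using assms(2) by (auto simp: inj_on_def)
  moreover have "Pow Y \<inter> insert c ` Pow Y = {}"
    using assms(2) by auto
  ultimately show ?thesis
    using assms(1) by (simp add: Pow_insert sum.union_disjoint sum.reindex sum.distrib)
qed

text \<open>Induction on \<open>Y\<close> with \<open>d\<close> left general: a new box outside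
  \<open>L\<close> changes the constant, so the induction hypothesis is used at two values of
  \<open>d\<close>.\<close>

lemma alternating_sum_Pow_prod:
  fixes x y t :: "'b \<Rightarrow> 'a::comm_ring_1"
  assumes "finite Y"
  shows "(\<Sum>L\<in>Pow Y. (-1) ^ card L * (d - (\<Sum>b\<in>Y - L. t b)) * (prod y L * prod x (Y - L)))
       = d * (\<Prod>b\<in>Y. x b - y b) - (\<Sum>b\<in>Y. t b * x b * (\<Prod>c\<in>Y - {b}. x c - y c))"
  using assms
proof (induction Y arbitrary: d rule: finite_induct)
  case empty
  then show ?case by simp
next
  case (insert c Y)
  let ?F = "\<lambda>d L. (-1) ^ card L * (d - (\<Sum>b\<in>Y - L. t b)) * (prod y L * prod x (Y - L))"
  let ?P = "\<lambda>Z. \<Prod>b\<in>Z. x b - y b"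
  let ?G = "\<lambda>L. (-1) ^ card L * (d - (\<Sum>b\<in>insert c Y - L. t b))
                    * (prod y L * prod x (insert c Y - L))"
  \<comment> \<open>With \<open>c\<close> outside \<open>L\<close>, the term \<open>t c\<close>
    merges into the constant and \<open>x c\<close> factors out; moving \<open>c\<close> into
    \<open>L\<close> keeps \<open>d\<close> and costs a sign and a factor
    \<open>y c\<close>.\<close>
  have step: "?G L + ?G (insert c L) = x c * ?F (d - t c) L - y c * ?F d L" if "L \<in> Pow Y" for L
  proof -
    have L: "finite L" "c \<notin> L" "finite (Y - L)" "c \<notin> Y - L"
      using that insert.hyps by (auto intro: finite_subset)
    have "insert c Y - L = insert c (Y - L)" "insert c Y - insert c L = Y - L"
      using L insert.hyps by auto
    with L show ?thesis by (simp add: algebra_simps)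
  qed
  have rest: "?P (insert c Y - {b}) = (x c - y c) * ?P (Y - {b})" if "b \<in> Y" for b
  proof -
    have "insert c Y - {b} = insert c (Y - {b})" using that insert.hyps by auto
    then show ?thesis using insert.hyps by simp
  qed
  have "(\<Sum>L\<in>Pow (insert c Y). ?G L) = x c * (\<Sum>L\<in>Pow Y. ?F (d - t c) L) - y c * (\<Sum>L\<in>Pow Y. ?F d L)"
    using insert.hyps step
    by (simp add: sum_Pow_insert sum_distrib_left sum_subtractf)
  also have "\<dots> = d * ((x c - y c) * ?P Y) - t c * x c * ?P Y
                    - (x c - y c) * (\<Sum>b\<in>Y. t b * x b * ?P (Y - {b}))"
    by (simp only: insert.IH) (simp add: algebra_simps)
  also have "\<dots> = d * ?P (insert c Y) - (\<Sum>b\<in>insert c Y. t b * x b * ?P (insert c Y - {b}))"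
    using insert.hyps by (simp add: rest sum_distrib_left mult.left_commute)
  finally show ?case .
qed

text \<open>The case \<open>y = x + s * \<beta>\<close>, \<open>t = s * a\<close> of the preceding
  identity. In the summand of \<open>b\<close>, the factor \<open>s b\<close> coming from
  \<open>t b\<close> completes the product of \<open>s\<close> over \<open>Y - {b}\<close> to all of
  \<open>Y\<close>.\<close>

lemma alternating_sum_Pow_prod_shift:
  fixes x a s :: "'b \<Rightarrow> 'a::comm_ring_1"
  assumes "finite Y" "Y \<noteq> {}"
  shows "(\<Sum>L\<in>Pow Y. (-1) ^ card L * (d - (\<Sum>b\<in>Y - L. s b * a b))
            * ((\<Prod>b\<in>L. x b + s b * \<beta>) * prod x (Y - L)))
       = (-1) ^ card Y * prod s Y * \<beta> ^ (card Y - 1) * ((\<Sum>b\<in>Y. a b * x b) + d * \<beta>)"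
proof -
  \<comment> \<open>Nonemptiness makes the truncated \<open>card Y - 1\<close> a true predecessor,
    so the term in \<open>d\<close> retains one more \<open>\<beta>\<close> than the others.\<close>
  obtain n where n: "card Y = Suc n"
    using assms by (cases "card Y") auto
  have P: "(\<Prod>b\<in>Z. x b - (x b + s b * \<beta>)) = (-1) ^ card Z * prod s Z * \<beta> ^ card Z" for Z
  proof -
    have "(\<Prod>b\<in>Z. x b - (x b + s b * \<beta>)) = (\<Prod>b\<in>Z. (-1) * (s b * \<beta>))" by simp
    also have "\<dots> = (-1) ^ card Z * prod s Z * \<beta> ^ card Z"
      by (simp only: prod.distrib prod_constant mult.assoc)
    finally show ?thesis .
  qed
  have "s b * a b * x b * (\<Prod>c\<in>Y - {b}. x c - (x c + s c * \<beta>))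
      = (-1) ^ n * prod s Y * \<beta> ^ n * (a b * x b)" if "b \<in> Y" for b
  proof -
    have "card (Y - {b}) = n" "prod s Y = s b * prod s (Y - {b})"
      using assms n that by (simp_all add: prod.remove)
    then show ?thesis unfolding P by (simp add: ac_simps)
  qed
  then have "(\<Sum>b\<in>Y. s b * a b * x b * (\<Prod>c\<in>Y - {b}. x c - (x c + s c * \<beta>)))
      = (-1) ^ n * prod s Y * \<beta> ^ n * (\<Sum>b\<in>Y. a b * x b)"
    unfolding sum_distrib_left by (rule sum.cong[OF refl])
  then show ?thesis
    unfolding alternating_sum_Pow_prod[OF assms(1)] P[of Y] n
    by (simp add: algebra_simps)
qed

text \<open>\<open>pconst\<close> embeds the rationals as a ring, which moves the coefficients of
  the kernel function into the polynomial ring, where the general identity applies.\<close>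

lemma pconst_zero: "pconst 0 = 0"
  and pconst_one: "pconst 1 = 1"
  and pconst_add: "pconst (p + q) = pconst p + pconst q"
  and pconst_uminus: "pconst (- p) = - pconst p"
  and pconst_diff: "pconst (p - q) = pconst p - pconst q"
  and pconst_mult: "pconst (p * q) = pconst p * pconst q"
  by (simp_all add: pconst_def single_add single_uminus single_diff mult_single)

lemma pconst_sum: "pconst (sum g A) = (\<Sum>b\<in>A. pconst (g b))"
  by (induction A rule: infinite_finite_induct) (simp_all add: pconst_zero pconst_add)

lemma pconst_power: "pconst (p ^ n) = pconst p ^ n"
  by (induction n) (simp_all add: pconst_one pconst_mult)

lemma pconst_kernel_coeff:
  "pconst (kernel_coeff B Y a d L) =
     (-1) ^ card L * (pconst d - (\<Sum>b\<in>Y - L. pconst (sigma (B b)) * pconst (a b)))"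
  by (simp add: kernel_coeff_def pconst_mult pconst_power pconst_uminus pconst_one pconst_diff
      pconst_sum)

text \<open>Splitting \<open>H\<close> into \<open>L\<close>, \<open>Y - L\<close> and
  \<open>H - Y\<close> isolates a factor independent of \<open>L\<close>, which can leave the sum
  over \<open>L\<close>.\<close>

lemma diagram_flip_on:
  assumes "finite H" "Y \<subseteq> H" "L \<subseteq> Y"
  shows "diagram H (flip_on B L) =
    (\<Prod>b\<in>L. hook b (B b) + pconst (sigma (B b)) * beta) * (\<Prod>b\<in>Y - L. hook b (B b))
      * (\<Prod>b\<in>H - Y. hook b (B b))"
proof -
  let ?h = "\<lambda>b. hook b (flip_on B L b)"
  have "diagram H (flip_on B L) = prod ?h L * prod ?h (Y - L) * prod ?h (H - Y)"
    unfolding diagram_def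
    using prod.subset_diff[OF assms(2,1), of ?h]
      prod.subset_diff[OF assms(3) finite_subset[OF assms(2,1)], of ?h]
    by (simp add: ac_simps)
  moreover have "prod ?h L = (\<Prod>b\<in>L. hook b (B b) + pconst (sigma (B b)) * beta)"
    by (intro prod.cong) (simp_all add: flip_on_def iffD2[OF hook_opp_iff refl])
  moreover have "prod ?h (Y - L) = (\<Prod>b\<in>Y - L. hook b (B b))"
    by (intro prod.cong) (simp_all add: flip_on_def)
  moreover have "prod ?h (H - Y) = (\<Prod>b\<in>H - Y. hook b (B b))"
    using assms(3) by (intro prod.cong) (auto simp: flip_on_def)
  ultimately show ?thesis by simp
qed

lemma kernel_function_eq:
  assumes "finite H" "Y \<subseteq> H" "Y \<noteq> {}"
  shows "kernel_function H B Y a d =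
           (-1) ^ card Y * (\<Prod>b\<in>Y. pconst (sigma (B b))) * (\<Prod>b\<in>H - Y. hook b (B b))
             * beta ^ (card Y - 1) * hook_form B Y a d"
proof -
  let ?s = "\<lambda>b. pconst (sigma (B b)) :: 'a hook_poly"
  let ?x = "\<lambda>b. hook b (B b)"
  have "kernel_function H B Y a d =
      (\<Sum>L\<in>Pow Y. (-1) ^ card L * (pconst d - (\<Sum>b\<in>Y - L. ?s b * pconst (a b)))
         * ((\<Prod>b\<in>L. ?x b + ?s b * beta) * prod ?x (Y - L))) * prod ?x (H - Y)"
    unfolding kernel_function_def sum_distrib_right
    by (intro sum.cong)
      (simp_all add: pconst_kernel_coeff diagram_flip_on[OF assms(1,2)] mult.assoc)
  also have "\<dots> = (-1) ^ card Y * prod ?s Y * beta ^ (card Y - 1) * hook_form B Y a d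
                    * prod ?x (H - Y)"
    unfolding hook_form_def
      alternating_sum_Pow_prod_shift[OF finite_subset[OF assms(2,1)] assms(3)] ..
  finally show ?thesis by (simp add: ac_simps)
qed

lemma hook_ring_one: "1 \<in> carrier (hook_ring H)"
  using pconst_in_hook_ring[of 1 H] by (simp add: pconst_one)

lemma hook_ring_power:
  "p \<in> carrier (hook_ring H) \<Longrightarrow> p ^ n \<in> carrier (hook_ring H)"
  by (induction n) (simp_all add: hook_ring_one hook_ring_mult)

lemma ring_hom_hook_ring_mult_zero:
  assumes "ring S" "\<phi> \<in> ring_hom (hook_ring H) S"
    and "p \<in> carrier (hook_ring H)" "q \<in> carrier (hook_ring H)" "\<phi> q = \<zero>\<^bsub>S\<^esub>"
  shows "\<phi> (p * q) = \<zero>\<^bsub>S\<^esub>"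
proof -
  have "\<phi> (p * q) = \<phi> p \<otimes>\<^bsub>S\<^esub> \<phi> q"
    using ring_hom_mult[OF assms(2-4)] by (simp add: hook_ring_def)
  then show ?thesis
    using assms(1,5) ring_hom_closed[OF assms(2,3)]
    by (simp add: ring.ring_simprules)
qed

theorem mainTheorem5:
  fixes H Y :: "'b set"
    and B :: "'b \<Rightarrow> side"
    and a :: "'b \<Rightarrow> rat"
    and d :: rat
  assumes "finite H" and "Y \<subseteq> H" and "Y \<noteq> {}"
  shows "kernel_function H B Y a d =
           (-1) ^ card Y * (\<Prod>b\<in>Y. pconst (sigma (B b))) * (\<Prod>b\<in>H - Y. hook b (B b))
             * beta ^ (card Y - 1) * hook_form B Y a d
         \<and> (\<forall>(S :: ('s, 'm) ring_scheme) \<phi>.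
              ring S \<longrightarrow> \<phi> \<in> ring_hom (hook_ring H) S \<longrightarrow> \<phi> (hook_form B Y a d) = \<zero>\<^bsub>S\<^esub>
              \<longrightarrow> \<phi> (kernel_function H B Y a d) = \<zero>\<^bsub>S\<^esub>)"
proof (intro conjI allI impI)
  show eq: "kernel_function H B Y a d =
           (-1) ^ card Y * (\<Prod>b\<in>Y. pconst (sigma (B b))) * (\<Prod>b\<in>H - Y. hook b (B b))
             * beta ^ (card Y - 1) * hook_form B Y a d"
    using assms by (rule kernel_function_eq)
  fix S :: "('s, 'm) ring_scheme" and \<phi>
  assume S: "ring S" and \<phi>: "\<phi> \<in> ring_hom (hook_ring H) S"
    and zero: "\<phi> (hook_form B Y a d) = \<zero>\<^bsub>S\<^esub>"
  \<comment> \<open>\<open>\<phi>\<close> is multiplicative only on the carrier, so the cofactor of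
    \<open>hook_form\<close> has to be shown to lie there.\<close>
  have "(-1) ^ card Y * (\<Prod>b\<in>Y. pconst (sigma (B b))) * (\<Prod>b\<in>H - Y. hook b (B b))
          * beta ^ (card Y - 1) \<in> carrier (hook_ring H)"
    by (intro hook_ring_mult hook_ring_power hook_ring_prod hook_ring_uminus hook_ring_one
        pconst_in_hook_ring beta_in_hook_ring hook_in_hook_ring) blast
  then show "\<phi> (kernel_function H B Y a d) = \<zero>\<^bsub>S\<^esub>"
    unfolding eq
    by (rule ring_hom_hook_ring_mult_zero[OF S \<phi> _ hook_form_in_hook_ring[OF assms(2)] zero])
qed

end
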